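(* a) Let $0<\alpha\le1$, $0<p<1/(1+\alpha)$, and let $\{q_k:k\in\mathbb N\}$ be a non-increasing sequence satisfying the condition $$\limsup_{n\to\infty}\frac{n^{\alpha}}{Q_n}=c>0 .$$ Then there exists a martingale $f\in H_p$ such that $$\sup_{n\in\mathbb N_+}\|t_nf\|_{weak-L_p}=\infty .$$ b) Let $0<\alpha\le1$ and let $\{q_k:k\in\mathbb N\}$ be a non-increasing sequence satisfying the condition $$\limsup_{n\to\infty}\frac{n^{\alpha}}{Q_n}=\infty .$$ Then there exists a martingale $f\in H_{1/(1+\alpha)}$ such that $$\sup_{n\in\mathbb N_+}\|t_nf\|_{weak-L_{1/(1+\alpha)}}=\infty .$$
   Context: $\mathbb N_+$ is the set of positive integers, $\mathbb N=\mathbb N_+\cup\{0\}$. Fix a bounded sequence $m=(m_0,m_1,\dots)$ of integers $m_k\ge 2$. $G_m=\prod_{k\ge0}Z_{m_k}$, where $Z_{m_k}=\{0,\dots,m_k-1\}$ is the additive group modulo $m_k$, with the product of the discrete topologies; $\mu$ is the Haar measure with $\mu(G_m)=1$. $M_0:=1$, $M_{k+1}:=m_kM_k$; every $n\in\mathbb N$ is uniquely $n=\sum_{j\ge0}n_jM_j$ with $n_j\in Z_{m_j}$. $r_k(x):=\exp(2\pi i x_k/m_k)$, $\psi_n:=\prod_{k\ge0}r_k^{n_k}$ (Vilenkin system). $I_0(x):=G_m$, $I_n(x):=\{y: y_0=x_0,\dots,y_{n-1}=x_{n-1}\}$; $\mathcal F_n$ is the $\sigma$-algebra generated by $\{I_n(x):x\in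 G_m\}$. For $g\in L_1(G_m)$: $\widehat g(k):=\int g\overline{\psi_k}\,d\mu$, $S_ng:=\sum_{k=0}^{n-1}\widehat g(k)\psi_k$. A martingale is a sequence $f=(f^{(n)}:n\in\mathbb N)$ of integrable functions with $f^{(n)}$ $\mathcal F_n$-measurable and $S_{M_n}f^{(k)}=f^{(n)}$ for $n\le k$; $f^*:=\sup_n|f^{(n)}|$; $H_p$ is the set of martingales with $\|f\|_{H_p}:=\|f^*\|_p<\infty$, where $\|g\|_p:=(\int|g|^pd\mu)^{1/p}$. For a martingale, $\widehat f(i):=\lim_k\int f^{(k)}\overline{\psi_i}\,d\mu$ and $S_nf:=\sum_{k=0}^{n-1}\widehat f(k)\psi_k$. For a sequence $\{q_k:k\in\mathbb N\}$ of nonnegative numbers, $Q_n:=\sum_{k=0}^{n-1}q_k$ and the Nörlund means are $t_nf:=\frac1{Q_n}\sum_{k=1}^nq_{n-k}S_kf$ ($n\in\mathbb N_+$); it is always assumed that $q_0>0$ and $Q_n\to\infty$. $\|g\|_{weak-L_p}:=\sup_{\lambda>0}\lambda\,\mu(|g|>\lambda)^{1/p}$. *)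

theory Defs
  imports "HOL-Probability.Probability"
begin

section \<open>Vilenkin groups\<close>

text \<open>The group is realised on sequences of natural numbers whose \<open>k\<close>-th entry is a residue
  in \<open>{..<m k}\<close>. Functions on the group are total HOL functions; only their values on
  \<open>vil_group m\<close> matter.\<close>

definition vil_group :: "(nat \<Rightarrow> nat) \<Rightarrow> (nat \<Rightarrow> nat) set" where
  "vil_group m = (\<Pi>\<^sub>E k\<in>UNIV. {..<m k})"

definition vil_topology :: "(nat \<Rightarrow> nat) \<Rightarrow> (nat \<Rightarrow> nat) topology" where
  "vil_topology m = product_topology (\<lambda>k. discrete_topology {..<m k}) UNIV"

definition vil_add :: "(nat \<Rightarrow> nat) \<Rightarrow> (nat \<Rightarrow> nat) \<Rightarrow> (nat \<Rightarrow> nat) \<Rightarrow> (nat \<Rightarrow> nat)" where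
  "vil_add m x y = (\<lambda>k. (x k + y k) mod m k)"

text \<open>Normalised Haar measure: the translation-invariant Borel probability measure. The group is
  compact, metrizable and abelian, so regularity is automatic and left invariance suffices.\<close>

definition haar_probability :: "(nat \<Rightarrow> nat) \<Rightarrow> (nat \<Rightarrow> nat) measure \<Rightarrow> bool" where
  "haar_probability m \<mu> \<longleftrightarrow>
     space \<mu> = vil_group m \<and>
     sets \<mu> = sigma_sets (vil_group m) {U. openin (vil_topology m) U} \<and>
     emeasure \<mu> (vil_group m) = 1 \<and>
     (\<forall>x\<in>vil_group m. \<forall>A\<in>sets \<mu>. emeasure \<mu> (vil_add m x ` A) = emeasure \<mu> A)"


section \<open>Vilenkin system and Fourier series\<close>

fun vil_M :: "(nat \<Rightarrow> nat) \<Rightarrow> nat \<Rightarrow> nat" where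
  "vil_M m 0 = 1"
| "vil_M m (Suc k) = m k * vil_M m k"

text \<open>The \<open>j\<close>-th digit \<open>n\<^sub>j\<close> of \<open>n\<close> in the mixed-radix expansion
  \<open>n = (\<Sum>j. n\<^sub>j * M\<^sub>j)\<close>; see \<open>vil_digit_expansion\<close> and \<open>vil_digit_unique\<close> below.\<close>

definition vil_digit :: "(nat \<Rightarrow> nat) \<Rightarrow> nat \<Rightarrow> nat \<Rightarrow> nat" where
  "vil_digit m n j = (n div vil_M m j) mod m j"

definition vil_r :: "(nat \<Rightarrow> nat) \<Rightarrow> nat \<Rightarrow> (nat \<Rightarrow> nat) \<Rightarrow> complex" where
  "vil_r m k x = exp (2 * complex_of_real pi * \<i> * of_nat (x k) / of_nat (m k))"

text \<open>All but finitely many factors are \<open>1\<close>.\<close>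

definition vil_psi :: "(nat \<Rightarrow> nat) \<Rightarrow> nat \<Rightarrow> (nat \<Rightarrow> nat) \<Rightarrow> complex" where
  "vil_psi m n x = (\<Prod>k. vil_r m k x ^ vil_digit m n k)"

definition vil_I :: "(nat \<Rightarrow> nat) \<Rightarrow> nat \<Rightarrow> (nat \<Rightarrow> nat) \<Rightarrow> (nat \<Rightarrow> nat) set" where
  "vil_I m n x = {y \<in> vil_group m. \<forall>k<n. y k = x k}"

definition vil_F :: "(nat \<Rightarrow> nat) \<Rightarrow> nat \<Rightarrow> (nat \<Rightarrow> nat) measure" where
  "vil_F m n = sigma (vil_group m) (vil_I m n ` vil_group m)"

definition fourier_coeff ::
  "(nat \<Rightarrow> nat) \<Rightarrow> (nat \<Rightarrow> nat) measure \<Rightarrow> ((nat \<Rightarrow> nat) \<Rightarrow> complex) \<Rightarrow> nat \<Rightarrow> complex" where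
  "fourier_coeff m \<mu> g k = (\<integral>x. g x * cnj (vil_psi m k x) \<partial>\<mu>)"

definition partial_sum ::
  "(nat \<Rightarrow> nat) \<Rightarrow> (nat \<Rightarrow> nat) measure \<Rightarrow> nat \<Rightarrow> ((nat \<Rightarrow> nat) \<Rightarrow> complex) \<Rightarrow> (nat \<Rightarrow> nat) \<Rightarrow> complex" where
  "partial_sum m \<mu> n g x = (\<Sum>k<n. fourier_coeff m \<mu> g k * vil_psi m k x)"


section \<open>Martingales and Hardy spaces\<close>

text \<open>Every \<open>vil_I m n x\<close> has positive measure, so for the \<open>\<F>\<^sub>n\<close>-measurable functions
  below equality almost everywhere is the same as equality on the whole group.\<close>

definition vil_martingale ::
  "(nat \<Rightarrow> nat) \<Rightarrow> (nat \<Rightarrow> nat) measure \<Rightarrow> (nat \<Rightarrow> (nat \<Rightarrow> nat) \<Rightarrow> complex) \<Rightarrow> bool" where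
  "vil_martingale m \<mu> f \<longleftrightarrow>
     (\<forall>n. integrable \<mu> (f n)) \<and>
     (\<forall>n. f n \<in> borel_measurable (vil_F m n)) \<and>
     (\<forall>n k. n \<le> k \<longrightarrow> (\<forall>x\<in>vil_group m. partial_sum m \<mu> (vil_M m n) (f k) x = f n x))"

definition maximal_function ::
  "(nat \<Rightarrow> (nat \<Rightarrow> nat) \<Rightarrow> complex) \<Rightarrow> (nat \<Rightarrow> nat) \<Rightarrow> ennreal" where
  "maximal_function f x = (SUP n. ennreal (norm (f n x)))"

text \<open>Real powers on \<open>[0,\<infinity>]\<close>, used only with exponents \<open>a > 0\<close>, where \<open>\<infinity>\<^sup>a = \<infinity>\<close>.\<close>

definition ennreal_powr :: "ennreal \<Rightarrow> real \<Rightarrow> ennreal" where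
  "ennreal_powr x a = (if x = \<infinity> then \<infinity> else ennreal (enn2real x powr a))"

text \<open>The (quasi-)norm takes a \<open>[0,\<infinity>]\<close>-valued argument, since \<open>f\<^sup>*\<close> may be infinite.\<close>

definition Lp_norm :: "'a measure \<Rightarrow> real \<Rightarrow> ('a \<Rightarrow> ennreal) \<Rightarrow> ennreal" where
  "Lp_norm \<mu> p g = ennreal_powr (\<integral>\<^sup>+ x. ennreal_powr (g x) p \<partial>\<mu>) (1 / p)"

definition weak_Lp_norm :: "'a measure \<Rightarrow> real \<Rightarrow> ('a \<Rightarrow> complex) \<Rightarrow> ennreal" where
  "weak_Lp_norm \<mu> p g =
     (SUP t\<in>{0<..}. ennreal t * ennreal_powr (emeasure \<mu> {x \<in> space \<mu>. norm (g x) > t}) (1 / p))"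

definition hardy_norm ::
  "(nat \<Rightarrow> nat) measure \<Rightarrow> real \<Rightarrow> (nat \<Rightarrow> (nat \<Rightarrow> nat) \<Rightarrow> complex) \<Rightarrow> ennreal" where
  "hardy_norm \<mu> p f = Lp_norm \<mu> p (maximal_function f)"

definition hardy_space ::
  "(nat \<Rightarrow> nat) \<Rightarrow> (nat \<Rightarrow> nat) measure \<Rightarrow> real \<Rightarrow> (nat \<Rightarrow> (nat \<Rightarrow> nat) \<Rightarrow> complex) set" where
  "hardy_space m \<mu> p = {f. vil_martingale m \<mu> f \<and> hardy_norm \<mu> p f < \<infinity>}"

definition martingale_coeff ::
  "(nat \<Rightarrow> nat) \<Rightarrow> (nat \<Rightarrow> nat) measure \<Rightarrow> (nat \<Rightarrow> (nat \<Rightarrow> nat) \<Rightarrow> complex) \<Rightarrow> nat \<Rightarrow> complex" where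
  "martingale_coeff m \<mu> f i = lim (\<lambda>k. fourier_coeff m \<mu> (f k) i)"

definition martingale_sum ::
  "(nat \<Rightarrow> nat) \<Rightarrow> (nat \<Rightarrow> nat) measure \<Rightarrow> nat \<Rightarrow> (nat \<Rightarrow> (nat \<Rightarrow> nat) \<Rightarrow> complex)
     \<Rightarrow> (nat \<Rightarrow> nat) \<Rightarrow> complex" where
  "martingale_sum m \<mu> n f x = (\<Sum>k<n. martingale_coeff m \<mu> f k * vil_psi m k x)"


section \<open>Noerlund means\<close>

definition norlund_Q :: "(nat \<Rightarrow> real) \<Rightarrow> nat \<Rightarrow> real" where
  "norlund_Q q n = (\<Sum>k<n. q k)"

definition norlund_weights :: "(nat \<Rightarrow> real) \<Rightarrow> bool" where
  "norlund_weights q \<longleftrightarrow>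
     (\<forall>k. 0 \<le> q k) \<and> 0 < q 0 \<and> filterlim (norlund_Q q) at_top sequentially"

definition norlund_mean ::
  "(nat \<Rightarrow> nat) \<Rightarrow> (nat \<Rightarrow> nat) measure \<Rightarrow> (nat \<Rightarrow> real) \<Rightarrow> nat \<Rightarrow> (nat \<Rightarrow> (nat \<Rightarrow> nat) \<Rightarrow> complex)
     \<Rightarrow> (nat \<Rightarrow> nat) \<Rightarrow> complex" where
  "norlund_mean m \<mu> q n f x =
     complex_of_real (1 / norlund_Q q n) *
       (\<Sum>k=1..n. complex_of_real (q (n - k)) * martingale_sum m \<mu> k f x)"


section \<open>Consistency of the encodings\<close>

lemma vil_M_pos:
  assumes "\<And>k. 2 \<le> m k"
  shows "0 < vil_M m k"
proof (induction k)
  case (Suc k)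
  then show ?case using assms[of k] by simp
qed simp

lemma vil_digit_expansion:
  assumes "n < vil_M m k"
  shows "n = (\<Sum>j<k. vil_digit m n j * vil_M m j)"
proof -
  have "n mod vil_M m k = (\<Sum>j<k. vil_digit m n j * vil_M m j)" for k
  proof (induction k)
    case (Suc k)
    have "n mod vil_M m (Suc k) = vil_M m k * (n div vil_M m k mod m k) + n mod vil_M m k"
      by (simp add: mod_mult2_eq mult.commute[of "m k"])
    then show ?case
      using Suc by (simp add: vil_digit_def mult.commute)
  qed simp
  then show ?thesis
    using assms by (metis mod_less)
qed

lemma vil_digit_unique:
  fixes m d :: "nat \<Rightarrow> nat" and n k j :: nat
  assumes m: "\<And>k. 2 \<le> m k" and d: "\<And>j. d j < m j" and n: "n = (\<Sum>j<k. d j * vil_M m j)" and jk: "j < k"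
  shows "vil_digit m n j = d j"
proof -
  have lt: "(\<Sum>j<i. d j * vil_M m j) < vil_M m i" for i
  proof (induction i)
    case (Suc i)
    have "(d i + 1) * vil_M m i \<le> m i * vil_M m i"
      using d[of i] by (intro mult_right_mono) auto
    then show ?case using Suc by (simp add: algebra_simps)
  qed simp
  have dv: "vil_M m (Suc j) dvd (\<Sum>i\<in>{Suc j..<k}. d i * vil_M m i)"
  proof (rule dvd_sum)
    fix i assume "i \<in> {Suc j..<k}"
    then have "Suc j \<le> i" by simp
    then have "vil_M m (Suc j) dvd vil_M m i"
      by (induction i rule: dec_induct) (auto intro: dvd_mult)
    then show "vil_M m (Suc j) dvd d i * vil_M m i" by (rule dvd_mult)
  qed
  then obtain c where c: "(\<Sum>i\<in>{Suc j..<k}. d i * vil_M m i) = vil_M m (Suc j) * c" by (rule dvdE)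
  have "n = (\<Sum>i<Suc j. d i * vil_M m i) + (\<Sum>i\<in>{Suc j..<k}. d i * vil_M m i)"
    unfolding n using jk
    by (metis Suc_leI lessThan_atLeast0 sum.atLeastLessThan_concat zero_le)
  then have "n = (\<Sum>i<j. d i * vil_M m i) + vil_M m j * (d j + m j * c)"
    unfolding c by (simp add: algebra_simps)
  then have "n div vil_M m j = d j + m j * c"
    using lt[of j] vil_M_pos[of m j, OF m] by simp
  then show ?thesis
    using d[of j] by (simp add: vil_digit_def)
qed

lemma vil_group_iff: "x \<in> vil_group m \<longleftrightarrow> (\<forall>k. x k < m k)"
  by (auto simp: vil_group_def PiE_iff)

lemma borel_vil_group:
  "sets (\<Pi>\<^sub>M k\<in>UNIV. uniform_count_measure {..<m k}) =
     sigma_sets (vil_group m) {U. openin (vil_topology m) U}" (is "sets ?P = ?R")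
proof
  have top: "topspace (vil_topology m) = vil_group m"
    by (simp add: vil_topology_def vil_group_def)
  show "sets ?P \<subseteq> ?R"
    unfolding sets_PiM_single
  proof (rule sigma_sets_subseteq[THEN order_trans, rotated])
    show "sigma_sets (\<Pi>\<^sub>E k\<in>UNIV. space (uniform_count_measure {..<m k}))
        {U. openin (vil_topology m) U} \<subseteq> ?R"
      by (simp add: vil_group_def space_uniform_count_measure)
  next
    show "{{f \<in> \<Pi>\<^sub>E k\<in>UNIV. space (uniform_count_measure {..<m k}). f i \<in> A} |i A.
        i \<in> UNIV \<and> A \<in> sets (uniform_count_measure {..<m i})} \<subseteq> {U. openin (vil_topology m) U}"
    proof clarsimp
      fix i A assume "A \<in> sets (uniform_count_measure {..<m i})"
      then have A: "openin (discrete_topology {..<m i}) A"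
        by (simp add: sets_uniform_count_measure)
      have "continuous_map (vil_topology m) (discrete_topology {..<m i}) (\<lambda>f. f i)"
        unfolding vil_topology_def by (rule continuous_map_product_projection) simp
      from openin_continuous_map_preimage[OF this A]
      show "openin (vil_topology m)
          {f \<in> \<Pi>\<^sub>E k\<in>UNIV. space (uniform_count_measure {..<m k}). f i \<in> A}"
        by (simp add: top vil_group_def space_uniform_count_measure)
    qed
  qed
  have sp: "space ?P = vil_group m"
    by (simp add: space_PiM vil_group_def space_uniform_count_measure)
  define cyl where "cyl xs = {y \<in> vil_group m. \<forall>k<length xs. y k = xs ! k}" for xs
  have coord: "{y \<in> space ?P. y k = a} \<in> sets ?P" for k a
  proof -
    have "(\<lambda>y. y k) \<in> measurable ?P (uniform_count_measure {..<m k})"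
      by (rule measurable_component_singleton) simp
    from measurable_sets[OF this, of "{a} \<inter> {..<m k}"]
    have "(\<lambda>y. y k) -` ({a} \<inter> {..<m k}) \<inter> space ?P \<in> sets ?P"
      by (simp add: sets_uniform_count_measure)
    also have "(\<lambda>y. y k) -` ({a} \<inter> {..<m k}) \<inter> space ?P = {y \<in> space ?P. y k = a}"
      by (auto simp: sp vil_group_iff)
    finally show ?thesis .
  qed
  have cyl: "cyl xs \<in> sets ?P" for xs
  proof -
    have "{y \<in> space ?P. \<forall>k\<in>{..<length xs}. y k = xs ! k} \<in> sets ?P"
      by (rule sets.sets_Collect_finite_All) (auto intro: coord)
    then show ?thesis unfolding cyl_def sp Ball_def lessThan_iff .
  qed
  have "U \<in> sets ?P" if U: "openin (vil_topology m) U" for U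
  proof -
    have sub: "U \<subseteq> vil_group m"
      using openin_subset[OF U] by (simp add: top)
    have ex: "\<exists>xs. x \<in> cyl xs \<and> cyl xs \<subseteq> U" if "x \<in> U" for x
    proof -
      from U \<open>x \<in> U\<close> obtain W where W: "finite {i. W i \<noteq> {..<m i}}"
          "x \<in> (\<Pi>\<^sub>E k\<in>UNIV. W k)" "(\<Pi>\<^sub>E k\<in>UNIV. W k) \<subseteq> U"
        unfolding vil_topology_def openin_product_topology_alt by fastforce
      obtain N where N: "\<forall>i\<in>{i. W i \<noteq> {..<m i}}. i < N"
        using W(1) by (metis finite_nat_set_iff_bounded)
      have "cyl (map x [0..<N]) \<subseteq> (\<Pi>\<^sub>E k\<in>UNIV. W k)"
      proof
        fix y assume y: "y \<in> cyl (map x [0..<N])"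
        have "y k \<in> W k" for k
        proof (cases "k < N")
          case True
          then show ?thesis using y W(2) by (auto simp: cyl_def PiE_iff)
        next
          case False
          then have "W k = {..<m k}" using N by auto
          then show ?thesis using y by (auto simp: cyl_def vil_group_iff)
        qed
        then show "y \<in> (\<Pi>\<^sub>E k\<in>UNIV. W k)" by (simp add: PiE_iff)
      qed
      moreover have "x \<in> cyl (map x [0..<N])"
        using sub \<open>x \<in> U\<close> by (auto simp: cyl_def)
      ultimately show ?thesis using W(3) by blast
    qed
    have "U = \<Union> (cyl ` {xs. cyl xs \<subseteq> U})"
      using ex by blast
    moreover have "\<Union> (cyl ` {xs. cyl xs \<subseteq> U}) \<in> sets ?P"
      by (rule sets.countable_UN'') (auto intro: cyl)
    ultimately show ?thesis by simp
  qed
  then show "?R \<subseteq> sets ?P"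
    using sets.sigma_sets_subset[of "{U. openin (vil_topology m) U}" ?P] by (auto simp: sp)
qed

theorem haar_probability_PiM:
  assumes m: "\<And>k. 2 \<le> m k"
  shows "haar_probability m (\<Pi>\<^sub>M k\<in>UNIV. uniform_count_measure {..<m k})"
proof -
  let ?u = "\<lambda>k. uniform_count_measure {..<m k}"
  let ?P = "\<Pi>\<^sub>M k\<in>UNIV. ?u k"
  have m0: "0 < m k" for k using m[of k] by simp
  have ps: "prob_space (?u k)" for k
    using m0[of k] by (intro prob_space_uniform_count_measure) auto
  interpret product_prob_space ?u UNIV
    by (intro product_prob_spaceI ps)
  have sp: "space ?P = vil_group m"
    by (simp add: space_PiM vil_group_def space_uniform_count_measure)
  have trans: "emeasure ?P (vil_add m x ` A) = emeasure ?P A"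
    if x: "x \<in> vil_group m" and A: "A \<in> sets ?P" for x A
  proof -
    define neg where "neg = (\<lambda>k. (m k - x k) mod m k)"
    have xk: "x k < m k" for k using x by (simp add: vil_group_iff)
    have inv1: "(x k + (neg k + a) mod m k) mod m k = a" if "a < m k" for k a
    proof -
      have "(x k + (neg k + a) mod m k) mod m k = (x k + (m k - x k) + a) mod m k"
        unfolding neg_def by (simp add: mod_simps add.assoc)
      also have "\<dots> = a" using xk[of k] that by simp
      finally show ?thesis .
    qed
    have inv2: "(neg k + (x k + a) mod m k) mod m k = a" if "a < m k" for k a
    proof -
      have "(neg k + (x k + a) mod m k) mod m k = ((m k - x k) + (x k + a)) mod m k"
        unfolding neg_def by (simp only: mod_simps)
      also have "\<dots> = a" using xk[of k] that by simp
      finally show ?thesis .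
    qed
    let ?T = "\<lambda>y. vil_add m neg y"
    have bij: "bij_betw (\<lambda>a. (x k + a) mod m k) {..<m k} {..<m k}" for k
      by (rule bij_betw_byWitness[where f' = "\<lambda>a. (neg k + a) mod m k"])
        (use inv1 inv2 m0 in auto)
    have T: "?T \<in> measurable ?P ?P"
    proof (rule measurable_PiM_single')
      fix k :: nat
      have "(\<lambda>y. y k) \<in> measurable ?P (?u k)"
        by (rule measurable_component_singleton) simp
      moreover have "(\<lambda>a. (neg k + a) mod m k) \<in> measurable (?u k) (?u k)"
        using m0[of k] by (auto simp: measurable_def space_uniform_count_measure sets_uniform_count_measure)
      ultimately show "(\<lambda>y. ?T y k) \<in> measurable ?P (?u k)"
        unfolding vil_add_def by (rule measurable_compose)
    next
      show "?T \<in> space ?P \<rightarrow> (\<Pi>\<^sub>E i\<in>UNIV. space (?u i))"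
        using m0 by (auto simp: sp vil_group_iff vil_add_def space_uniform_count_measure)
    qed
    have "distr ?P ?P ?T = ?P"
    proof (rule PiM_eq)
      show "sets (distr ?P ?P ?T) = sets ?P" by simp
      fix J F assume J: "finite J" "J \<subseteq> UNIV" and F: "\<And>j. j \<in> J \<Longrightarrow> F j \<in> sets (?u j)"
      let ?F' = "\<lambda>j. (\<lambda>a. (x j + a) mod m j) ` F j"
      have F_sub: "F j \<subseteq> {..<m j}" if "j \<in> J" for j
        using F[OF that] by (simp add: sets_uniform_count_measure)
      have F': "?F' j \<in> sets (?u j)" if "j \<in> J" for j
        using m0 by (auto simp: sets_uniform_count_measure)
      have emb: "emb UNIV J (Pi\<^sub>E J G) = {y \<in> vil_group m. \<forall>j\<in>J. y j \<in> G j}" for G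
        by (auto simp: prod_emb_def vil_group_iff PiE_iff space_uniform_count_measure restrict_def)
      have meas: "emb UNIV J (Pi\<^sub>E J F) \<in> sets ?P"
        using J F by (intro sets_PiM_I) auto
      have "?T -` emb UNIV J (Pi\<^sub>E J F) \<inter> space ?P = emb UNIV J (Pi\<^sub>E J ?F')"
      proof -
        have "(neg j + y j) mod m j \<in> F j \<longleftrightarrow> y j \<in> ?F' j" if "j \<in> J" "y \<in> vil_group m" for j y
        proof
          assume "(neg j + y j) mod m j \<in> F j"
          then show "y j \<in> ?F' j"
            using inv1[of "y j" j] that(2) by (auto simp: vil_group_iff image_iff intro!: bexI)
        next
          assume "y j \<in> ?F' j"
          then obtain a where "a \<in> F j" "y j = (x j + a) mod m j" by auto
          then show "(neg j + y j) mod m j \<in> F j"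
            using inv2[of a j] F_sub[OF that(1)] by auto
        qed
        moreover have "?T y \<in> vil_group m" for y
          using m0 by (simp add: vil_group_iff vil_add_def)
        ultimately show ?thesis
          by (auto simp: emb sp vil_add_def)
      qed
      then have "emeasure (distr ?P ?P ?T) (emb UNIV J (Pi\<^sub>E J F)) = emeasure ?P (emb UNIV J (Pi\<^sub>E J ?F'))"
        using T meas by (simp add: emeasure_distr)
      also have "\<dots> = (\<Prod>j\<in>J. emeasure (?u j) (?F' j))"
        using J F' by (intro emeasure_PiM_emb) auto
      also have "\<dots> = (\<Prod>j\<in>J. emeasure (?u j) (F j))"
      proof (rule prod.cong)
        fix j assume j: "j \<in> J"
        have "card (?F' j) = card (F j)"
          using bij[of j] F_sub[OF j] by (meson bij_betw_imp_inj_on card_image inj_on_subset)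
        then show "emeasure (?u j) (?F' j) = emeasure (?u j) (F j)"
          using F_sub[OF j] F'[OF j]
          by (simp add: emeasure_uniform_count_measure sets_uniform_count_measure)
      qed simp
      finally show "emeasure (distr ?P ?P ?T) (emb UNIV J (Pi\<^sub>E J F)) = (\<Prod>j\<in>J. emeasure (?u j) (F j))" .
    qed
    then have "emeasure ?P A = emeasure (distr ?P ?P ?T) A" by simp
    also have "\<dots> = emeasure ?P (?T -` A \<inter> space ?P)"
      using T A by (rule emeasure_distr)
    also have "?T -` A \<inter> space ?P = vil_add m x ` A"
    proof -
      have Asub: "A \<subseteq> vil_group m" using sets.sets_into_space[OF A] by (simp add: sp)
      have i1: "vil_add m x (?T y) = y" if "y \<in> vil_group m" for y
        using that inv1 by (auto simp: vil_add_def vil_group_iff)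
      have i2: "?T (vil_add m x y) = y" if "y \<in> vil_group m" for y
        using that inv2 by (auto simp: vil_add_def vil_group_iff)
      have "vil_add m x y \<in> vil_group m" for y
        using m0 by (simp add: vil_group_iff vil_add_def)
      then show ?thesis
        using i1 i2 Asub by (force simp: sp image_iff)
    qed
    finally show ?thesis by simp
  qed
  show ?thesis
    unfolding haar_probability_def
    using trans borel_vil_group[of m] emeasure_space_1 by (auto simp: sp)
qed

end

theory Submission
  imports Defs
begin

text \<open>The witness is the lacunary series \<open>f = (\<Sum>j. d\<^sub>j r\<^sub>j D\<^bsub>M\<^sub>j\<^esub>)\<close>, whose Fourier
  coefficients equal \<open>d\<^sub>j\<close> on the block \<open>M\<^sub>j \<le> i < 2 M\<^sub>j\<close> and vanish elsewhere. Since the Dirichlet kernel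
  \<open>D\<^bsub>M\<^sub>j\<^esub>\<close> is \<open>M\<^sub>j\<close> times the indicator of \<open>I\<^sub>j(0)\<close>, subadditivity of \<open>t \<mapsto> t\<^sup>p\<close> gives
  \<open>\<integral>(f\<^sup>*)\<^sup>p \<le> (\<Sum>j. (d\<^sub>j M\<^sub>j)\<^sup>p / M\<^sub>j)\<close>. The Noerlund mean of order \<open>n = M\<^sub>j + 1\<close> sees only the first
  coefficient of block \<open>j\<close>, with weight \<open>q\<^sub>0 / Q\<^sub>n\<close>; all earlier partial sums are bounded by
  \<open>(\<Sum>l<j. d\<^sub>l M\<^sub>l)\<close>, so \<open>|t\<^sub>n f| \<ge> q\<^sub>0 d\<^sub>j / Q\<^sub>n - (\<Sum>l<j. d\<^sub>l M\<^sub>l)\<close> everywhere. Both hypotheses make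
  \<open>M\<^sub>j\<^bsup>1/p-1\<^esup> / Q\<^sub>n\<close> unbounded, because \<open>m\<close> is bounded and \<open>Q\<close> increasing; taking
  \<open>d\<^sub>j = 2\<^bsup>-k/p\<^esup> M\<^sub>j\<^bsup>1/p-1\<^esup>\<close> along a sufficiently sparse sequence \<open>j = N\<^sub>k\<close> and \<open>d\<^sub>j = 0\<close> otherwise
  keeps \<open>f\<close> in \<open>H\<^sub>p\<close> while the means blow up.\<close>

text \<open>Divided by the total \<open>s\<close>, every term lies in [0,1], where
  \<open>t \<le> t powr p\<close>; the quotients sum to 1. A zero total is harmless since
  \<open>0 powr p = 0\<close>.\<close>

lemma powr_sum_le:
  fixes b :: "'a \<Rightarrow> real"
  assumes "finite A" and b: "\<And>i. i \<in> A \<Longrightarrow> 0 \<le> b i" and p: "0 < p" "p \<le> 1"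
  shows "sum b A powr p \<le> (\<Sum>i\<in>A. b i powr p)"
proof (cases "sum b A = 0")
  case True
  then show ?thesis by (simp add: sum_nonneg)
next
  case False
  define s where "s = sum b A"
  have s: "0 < s" using False b sum_nonneg[of A b] by (simp add: s_def less_le)
  have "b i / s \<le> b i powr p / s powr p" if "i \<in> A" for i
  proof -
    have "b i \<le> s" unfolding s_def using assms(1) b that by (intro member_le_sum) auto
    then have "b i / s \<le> (b i / s) powr p"
      using s p b[OF that] powr_mono'[of p 1 "b i / s"] by simp
    then show ?thesis using s b[OF that] by (simp add: powr_divide)
  qed
  then have "(\<Sum>i\<in>A. b i / s) \<le> (\<Sum>i\<in>A. b i powr p / s powr p)" by (rule sum_mono)
  then have "s / s \<le> (\<Sum>i\<in>A. b i powr p) / s powr p"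
    unfolding s_def by (simp only: sum_divide_distrib)
  then show ?thesis using s by (simp add: s_def field_simps)
qed

section \<open>The group, its coordinates and its characters\<close>

locale vilenkin =
  fixes m :: "nat \<Rightarrow> nat" and \<mu> :: "(nat \<Rightarrow> nat) measure"
  assumes m2: "2 \<le> m k" and haar: "haar_probability m \<mu>"
begin

abbreviation M :: "nat \<Rightarrow> nat" where "M \<equiv> vil_M m"

lemma m_pos: "0 < m k"
  using m2[of k] by simp

lemma M_pos: "0 < M k"
  by (intro vil_M_pos m2)

lemma two_M_le: "2 * M k \<le> M (Suc k)"
  using m2[of k] by simp

lemma M_mono: "i \<le> j \<Longrightarrow> M i \<le> M j"
proof (rule lift_Suc_mono_le[of M])
  show "M k \<le> M (Suc k)" for k using two_M_le[of k] by linarith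
qed

lemma power_le_M: "2 ^ k \<le> M k"
proof (induction k)
  case (Suc k)
  then show ?case using two_M_le[of k] unfolding power_Suc by linarith
qed simp

text \<open>Allows \<open>n\<close> itself as a crude bound for the number of nonzero digits of
  \<open>n\<close>, so that \<open>psi_eq_prod\<close> applies to every index.\<close>

lemma less_M: "k < M k"
  using power_le_M[of k] less_exp[of k] by linarith

lemma space_mu: "space \<mu> = vil_group m"
  and emeasure_mu: "emeasure \<mu> (vil_group m) = 1"
  using haar by (auto simp: haar_probability_def)

lemma sets_mu: "sets \<mu> = sets (\<Pi>\<^sub>M k\<in>UNIV. uniform_count_measure {..<m k})"
  using haar borel_vil_group[of m] by (simp add: haar_probability_def)

lemma translation_invariant:
  "x \<in> vil_group m \<Longrightarrow> A \<in> sets \<mu> \<Longrightarrow> emeasure \<mu> (vil_add m x ` A) = emeasure \<mu> A"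
  using haar by (auto simp: haar_probability_def)

sublocale prob_space \<mu>
  by standard (simp add: space_mu emeasure_mu)

lemma coordinate_measurable [measurable]: "(\<lambda>x. x k) \<in> measurable \<mu> (count_space UNIV)"
proof -
  have "(\<lambda>x. x k) \<in> measurable (\<Pi>\<^sub>M k\<in>UNIV. uniform_count_measure {..<m k})
      (uniform_count_measure {..<m k})"
    by (rule measurable_component_singleton) simp
  moreover have "(\<lambda>x. x) \<in> measurable (uniform_count_measure {..<m k}) (count_space UNIV)"
    by (auto simp: measurable_def space_uniform_count_measure sets_uniform_count_measure)
  ultimately have "(\<lambda>x. x k) \<in> measurable (\<Pi>\<^sub>M k\<in>UNIV. uniform_count_measure {..<m k}) (count_space UNIV)"
    by (rule measurable_compose)
  then show ?thesis
    using measurable_cong_sets[OF sets_mu refl] by blast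
qed

lemma r_eq_power: "vil_r m k x = exp (2 * complex_of_real pi * \<i> / of_nat (m k)) ^ x k"
  by (simp add: vil_r_def exp_of_nat_mult[symmetric] field_simps)

lemma norm_r: "norm (vil_r m k x) = 1"
  by (simp add: vil_r_def norm_exp_eq_Re)

text \<open>The root of unity \<open>w\<close> has order dividing \<open>m k\<close>, so the
  reduction modulo \<open>m k\<close> in \<open>vil_add\<close> disappears in the exponent.\<close>

lemma r_add: "vil_r m k (vil_add m x y) = vil_r m k x * vil_r m k y"
proof -
  define w where "w = exp (2 * complex_of_real pi * \<i> / of_nat (m k))"
  have "w ^ m k = 1" using m_pos[of k] by (simp add: w_def exp_of_nat_mult[symmetric])
  then have "w ^ (a mod m k) = w ^ a" for a
    by (metis mult_div_mod_eq power_add power_mult power_one mult_1)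
  then show ?thesis by (simp add: r_eq_power w_def[symmetric] vil_add_def power_add)
qed

lemma digit_zero: "n < M k \<Longrightarrow> k \<le> j \<Longrightarrow> vil_digit m n j = 0"
  using M_mono[of k j] by (simp add: vil_digit_def)

lemma psi_eq_prod:
  assumes "n < M k"
  shows "vil_psi m n x = (\<Prod>j<k. vil_r m j x ^ vil_digit m n j)"
  unfolding vil_psi_def by (rule prodinf_finite) (use digit_zero[OF assms] in auto)

lemma psi_0: "vil_psi m 0 x = 1"
  using psi_eq_prod[of 0 0] by simp

lemma norm_psi: "norm (vil_psi m n x) = 1"
  by (simp add: psi_eq_prod[OF less_M] prod_norm[symmetric] norm_power norm_r)

lemma psi_add: "vil_psi m n (vil_add m x y) = vil_psi m n x * vil_psi m n y"
  by (simp add: psi_eq_prod[OF less_M] r_add power_mult_distrib prod.distrib)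

lemma psi_measurable [measurable]: "vil_psi m n \<in> borel_measurable \<mu>"
proof -
  have "(\<lambda>x. \<Prod>j<n. vil_r m j x ^ vil_digit m n j) \<in> borel_measurable \<mu>"
    unfolding vil_r_def by measurable
  then show ?thesis by (simp add: psi_eq_prod[OF less_M] cong: measurable_cong)
qed

text \<open>Adding \<open>a * M k\<close> to \<open>i < M k\<close> writes the digit
  \<open>a\<close> at position \<open>k\<close> and leaves all lower digits unchanged.\<close>

lemma psi_shift:
  assumes i: "i < M k" and a: "a < m k"
  shows "vil_psi m (a * M k + i) x = vil_r m k x ^ a * vil_psi m i x"
proof -
  have "a * M k + i < (a + 1) * M k" using i by simp
  also have "\<dots> \<le> m k * M k" using a by (intro mult_right_mono) auto
  finally have lt: "a * M k + i < M (Suc k)" by simp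
  have "vil_digit m (a * M k + i) k = a" using i a by (simp add: vil_digit_def)
  moreover have "vil_digit m (a * M k + i) j = vil_digit m i j" if "j < k" for j
  proof -
    \<comment> \<open>\<open>a * M k\<close> contributes a multiple of \<open>m j\<close> to the
      quotient by \<open>M j\<close>, hence nothing to digit \<open>j\<close>.\<close>
    have "M (Suc j) dvd M k" using that[THEN Suc_leI]
      by (induction k rule: dec_induct) (auto intro: dvd_mult)
    then obtain c where "M k = M (Suc j) * c" by (rule dvdE)
    then have c: "M k = m j * c * M j" by simp
    have "(a * M k + i) div M j = a * m j * c + i div M j"
      unfolding c using M_pos[of j] div_mult_self3[of "M j" "a * m j * c" i] by (simp add: ac_simps)
    moreover have "(a * m j * c + i div M j) mod m j = i div M j mod m j"
      by (metis mod_mult_self4 mult.assoc mult.commute)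
    ultimately show ?thesis by (simp add: vil_digit_def)
  qed
  ultimately show ?thesis
    unfolding psi_eq_prod[OF lt] psi_eq_prod[OF i] by (simp add: mult.commute)
qed

section \<open>Translation invariance\<close>

lemma neg_exists:
  assumes "x \<in> vil_group m"
  obtains z where "z \<in> vil_group m" "\<And>y. y \<in> vil_group m \<Longrightarrow> vil_add m x (vil_add m z y) = y"
    "\<And>y. y \<in> vil_group m \<Longrightarrow> vil_add m z (vil_add m x y) = y"
proof
  \<comment> \<open>The outer \<open>mod\<close> matters at \<open>x k = 0\<close>, where
    \<open>m k - x k\<close> is not a residue.\<close>
  let ?z = "\<lambda>k. (m k - x k) mod m k"
  show "?z \<in> vil_group m" using m_pos by (auto simp: vil_group_iff)
  fix y assume y: "y \<in> vil_group m"
  have *: "(x k + ((m k - x k) + y k)) mod m k = y k" for k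
  proof -
    have "x k + ((m k - x k) + y k) = m k + y k"
      using assms[unfolded vil_group_iff, rule_format, of k] by linarith
    then show ?thesis using y by (simp add: vil_group_iff)
  qed
  show "vil_add m x (vil_add m ?z y) = y"
    unfolding vil_add_def by (intro ext) (metis * mod_add_left_eq mod_add_right_eq)
  show "vil_add m ?z (vil_add m x y) = y"
    unfolding vil_add_def by (intro ext) (metis * add.left_commute mod_add_left_eq mod_add_right_eq)
qed

lemma add_in_group: "vil_add m x y \<in> vil_group m"
  using m_pos by (simp add: vil_add_def vil_group_iff)

lemma add_measurable: "vil_add m x \<in> measurable \<mu> \<mu>"
proof -
  have "vil_add m x \<in> measurable \<mu> (\<Pi>\<^sub>M k\<in>UNIV. uniform_count_measure {..<m k})"
  proof (rule measurable_PiM_single')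
    fix k :: nat
    have "(\<lambda>a. (x k + a) mod m k) \<in> measurable (count_space UNIV) (uniform_count_measure {..<m k})"
      using m_pos by (simp add: space_uniform_count_measure)
    with coordinate_measurable[of k]
    show "(\<lambda>y. vil_add m x y k) \<in> measurable \<mu> (uniform_count_measure {..<m k})"
      unfolding vil_add_def by (rule measurable_compose)
  next
    show "vil_add m x \<in> space \<mu> \<rightarrow> (\<Pi>\<^sub>E i\<in>UNIV. space (uniform_count_measure {..<m i}))"
      using m_pos by (auto simp: vil_add_def space_uniform_count_measure)
  qed
  then show ?thesis
    using measurable_cong_sets[OF refl sets_mu, of \<mu>] by blast
qed

text \<open>Invariance is given for images, while push-forward measures involve preimages. The
  preimage of a set under translation by \<open>x\<close> is its image under translation by the
  inverse \<open>z\<close>.\<close>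

lemma distr_add:
  assumes x: "x \<in> vil_group m"
  shows "distr \<mu> \<mu> (vil_add m x) = \<mu>"
proof (rule measure_eqI)
  fix A assume "A \<in> sets (distr \<mu> \<mu> (vil_add m x))"
  then have A: "A \<in> sets \<mu>" by simp
  have sub: "A \<subseteq> vil_group m" using sets.sets_into_space[OF A] by (simp add: space_mu)
  obtain z where z: "z \<in> vil_group m" "\<And>y. y \<in> vil_group m \<Longrightarrow> vil_add m x (vil_add m z y) = y"
    "\<And>y. y \<in> vil_group m \<Longrightarrow> vil_add m z (vil_add m x y) = y"
    using neg_exists[OF x] by blast
  have "vil_add m x -` A \<inter> space \<mu> = vil_add m z ` A"
  proof (intro set_eqI iffI)
    fix y assume "y \<in> vil_add m x -` A \<inter> space \<mu>"
    then show "y \<in> vil_add m z ` A" using z(3)[of y] by (metis IntE image_eqI space_mu vimageE)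
  next
    fix y assume "y \<in> vil_add m z ` A"
    then show "y \<in> vil_add m x -` A \<inter> space \<mu>"
      using z(2) sub add_in_group by (auto simp: space_mu)
  qed
  then show "emeasure (distr \<mu> \<mu> (vil_add m x)) A = emeasure \<mu> A"
    using translation_invariant[OF z(1) A] by (simp add: emeasure_distr[OF add_measurable A])
qed simp

section \<open>Orthonormality of the Vilenkin system\<close>

lemma cnj_psi_measurable [measurable]: "(\<lambda>x. cnj (vil_psi m n x)) \<in> borel_measurable \<mu>"
  by (rule measurable_compose[OF psi_measurable borel_measurable_continuous_onI])
    (intro continuous_intros)

lemma psi_mult_cnj: "vil_psi m n x * cnj (vil_psi m n x) = 1"
  using complex_norm_square[of "vil_psi m n x"] by (simp add: norm_psi)

lemma psi_integrable [simp]: "integrable \<mu> (\<lambda>x. vil_psi m i x * cnj (vil_psi m k x))"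
  by (rule integrable_const_bound[of _ 1]) (auto simp: norm_mult norm_psi)

text \<open>Distinct indices differ in some digit \<open>j\<close>. At the unit vector in direction
  \<open>j\<close> the character of index \<open>n\<close> is a root of unity that determines digit
  \<open>j\<close> of \<open>n\<close>.\<close>

lemma psi_separates:
  assumes "i \<noteq> k"
  obtains y where "y \<in> vil_group m" "vil_psi m i y \<noteq> vil_psi m k y"
proof -
  define N where "N = max i k"
  have N: "i < M N" "k < M N"
    using less_M[of N] by (auto simp: N_def)
  obtain j where j: "j < N" "vil_digit m i j \<noteq> vil_digit m k j"
    using vil_digit_expansion[OF N(1)] vil_digit_expansion[OF N(2)] assms
    by (metis (no_types, lifting) lessThan_iff sum.cong)
  define y where "y = (\<lambda>l. if l = j then 1 else 0 :: nat)"
  have "y \<in> vil_group m" using m2 m_pos by (auto simp: y_def vil_group_iff Suc_le_eq[symmetric] numeral_2_eq_2)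
  moreover have *: "vil_psi m n y = exp (2 * complex_of_real pi * \<i> * of_nat (vil_digit m n j) / of_nat (m j))"
    if "n < M N" for n
  proof -
    have "vil_psi m n y = (\<Prod>l<N. if l = j then vil_r m j y ^ vil_digit m n j else 1)"
      unfolding psi_eq_prod[OF that] by (rule prod.cong) (auto simp: y_def r_eq_power)
    also have "\<dots> = vil_r m j y ^ vil_digit m n j" using j(1) by simp
    also have "\<dots> = exp (2 * complex_of_real pi * \<i> * of_nat (vil_digit m n j) / of_nat (m j))"
      by (simp add: r_eq_power y_def exp_of_nat_mult[symmetric] field_simps)
    finally show ?thesis .
  qed
  moreover have "vil_psi m i y \<noteq> vil_psi m k y"
    unfolding *[OF N(1)] *[OF N(2)] using m_pos[of j] j(2)
    by (subst complex_root_unity_eq) (auto simp: vil_digit_def)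
  ultimately show thesis using that by blast
qed

text \<open>For \<open>i \<noteq> k\<close>, translating by a separating point \<open>y\<close>
  multiplies the integral by \<open>?chi y\<close>, which differs from 1; by invariance the integral
  is 0.\<close>

lemma psi_orthonormal:
  "(\<integral>x. vil_psi m i x * cnj (vil_psi m k x) \<partial>\<mu>) = (if i = k then 1 else 0)"
proof (cases "i = k")
  case True
  then show ?thesis by (simp add: psi_mult_cnj prob_space)
next
  case False
  let ?chi = "\<lambda>x. vil_psi m i x * cnj (vil_psi m k x)"
  obtain y where y: "y \<in> vil_group m" "vil_psi m i y \<noteq> vil_psi m k y"
    using psi_separates[OF False] .
  have "(\<integral>x. ?chi x \<partial>\<mu>) = (\<integral>x. ?chi x \<partial>distr \<mu> \<mu> (vil_add m y))"
    by (simp add: distr_add[OF y(1)])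
  also have "\<dots> = (\<integral>x. ?chi (vil_add m y x) \<partial>\<mu>)"
    by (rule integral_distr[OF add_measurable]) measurable
  also have "\<dots> = (\<integral>x. ?chi y * ?chi x \<partial>\<mu>)" by (simp add: psi_add ac_simps)
  also have "\<dots> = ?chi y * (\<integral>x. ?chi x \<partial>\<mu>)" by simp
  finally have "?chi y = 1 \<or> (\<integral>x. ?chi x \<partial>\<mu>) = 0" by (metis mult_cancel_right1)
  moreover have "?chi y \<noteq> 1"
  proof
    assume "?chi y = 1"
    then have "vil_psi m i y * (cnj (vil_psi m k y) * vil_psi m k y) = vil_psi m k y" by simp
    moreover have "cnj (vil_psi m k y) * vil_psi m k y = 1"
      by (simp add: psi_mult_cnj mult.commute)
    ultimately show False using y(2) by simp
  qed
  ultimately show ?thesis using False by simp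
qed

section \<open>Dirichlet kernels of order \<open>M k\<close>\<close>

text \<open>Grouping the indices below \<open>M (Suc k)\<close> by their digit at \<open>k\<close>
  splits off the sum of all powers of \<open>vil_r m k x\<close>. This geometric sum vanishes unless
  \<open>x k = 0\<close>.\<close>

lemma dirichlet_kernel:
  assumes x: "x \<in> vil_group m"
  shows "(\<Sum>i<M k. vil_psi m i x) = (if \<forall>j<k. x j = 0 then of_nat (M k) else 0)"
proof (induction k)
  case 0
  then show ?case by (simp add: psi_0)
next
  case (Suc k)
  have "(\<Sum>i<M (Suc k). vil_psi m i x) = (\<Sum>a<m k. \<Sum>i\<in>{a * M k..<a * M k + M k}. vil_psi m i x)"
    by (simp add: sum.nat_group)
  also have "\<dots> = (\<Sum>a<m k. \<Sum>i<M k. vil_psi m (a * M k + i) x)"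
    by (subst sum.atLeastLessThan_shift_0) (simp add: atLeast0LessThan)
  also have "\<dots> = (\<Sum>a<m k. vil_r m k x ^ a) * (\<Sum>i<M k. vil_psi m i x)"
    by (simp add: psi_shift sum_product)
  also have "(\<Sum>a<m k. vil_r m k x ^ a) = (if x k = 0 then of_nat (m k) else 0)"
  proof (cases "x k = 0")
    case True
    then show ?thesis by (simp add: vil_r_def)
  next
    case False
    have "vil_r m k x ^ m k = 1"
      using m_pos[of k] by (simp add: vil_r_def exp_of_nat_mult[symmetric])
        (metis exp_of_nat2_mult exp_two_pi_i mult.commute power_one)
    moreover have "vil_r m k x \<noteq> 1"
    proof -
      have "x k < m k" using x by (simp add: vil_group_iff)
      then have "\<not> m k dvd x k" using False by (simp add: nat_dvd_not_less)
      then show ?thesis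
        unfolding vil_r_def using m_pos[of k] by (subst complex_root_unity_eq_1) auto
    qed
    ultimately show ?thesis using False by (simp add: geometric_sum)
  qed
  finally show ?case using Suc.IH by (auto simp: less_Suc_eq)
qed

lemma I_sets [measurable]: "vil_I m n x \<in> sets \<mu>"
proof -
  have "vil_I m n x = {y \<in> space \<mu>. \<forall>k<n. y k = x k}" by (simp add: vil_I_def space_mu)
  also have "\<dots> \<in> sets \<mu>" by measurable
  finally show ?thesis .
qed

lemma dirichlet_kernel_indicator:
  assumes "x \<in> vil_group m"
  shows "(\<Sum>i<M k. vil_psi m i x) = of_real (M k * (indicator (vil_I m k (\<lambda>_. 0)) x :: real))"
  using assms by (auto simp: dirichlet_kernel vil_I_def indicator_def)

text \<open>The kernel of order \<open>M k\<close> has integral 1, since only the constant character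
  contributes, and it is \<open>M k\<close> times the indicator of the cell.\<close>

lemma measure_I_zero: "M k * measure \<mu> (vil_I m k (\<lambda>_. 0)) = 1"
proof -
  have "complex_of_real (M k * measure \<mu> (vil_I m k (\<lambda>_. 0))) =
      of_real (\<integral>x. M k * (indicator (vil_I m k (\<lambda>_. 0)) x :: real) \<partial>\<mu>)"
    by (simp add: Int_absorb2 sets.sets_into_space)
  also have "\<dots> = (\<integral>x. of_real (M k * (indicator (vil_I m k (\<lambda>_. 0)) x :: real)) \<partial>\<mu>)"
    by (intro integral_of_real[symmetric] integrable_mult_right integrable_real_indicator)
      (auto simp: less_top[symmetric])
  \<comment> \<open>The conjugated constant character is inserted as a factor 1 to match the form of
    \<open>psi_orthonormal\<close>.\<close>
  also have "\<dots> = (\<integral>x. (\<Sum>i<M k. vil_psi m i x * cnj (vil_psi m 0 x)) \<partial>\<mu>)"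
    by (rule Bochner_Integration.integral_cong[OF refl]) (simp only: space_mu dirichlet_kernel_indicator psi_0 complex_cnj_one mult_1_right)
  also have "\<dots> = (\<Sum>i<M k. if i = 0 then 1 else 0)"
    by (simp only: Bochner_Integration.integral_sum psi_integrable psi_orthonormal)
  also have "\<dots> = of_real 1" using M_pos[of k] by simp
  finally show ?thesis unfolding of_real_eq_iff .
qed

section \<open>The lacunary series and its martingale\<close>

text \<open>The sum has at most one term: the blocks are disjoint because
  \<open>2 * M j \<le> M (Suc j)\<close>. Writing a sum gives the value 0 off the blocks without a
  case distinction.\<close>

definition block_coeff :: "(nat \<Rightarrow> real) \<Rightarrow> nat \<Rightarrow> real" where
  "block_coeff d i = (\<Sum>j | M j \<le> i \<and> i < 2 * M j. d j)"

definition block_martingale :: "(nat \<Rightarrow> real) \<Rightarrow> nat \<Rightarrow> (nat \<Rightarrow> nat) \<Rightarrow> complex" where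
  "block_martingale d n x = (\<Sum>i<M n. of_real (block_coeff d i) * vil_psi m i x)"

lemma block_coeff_in:
  assumes "M j \<le> i" "i < 2 * M j"
  shows "block_coeff d i = d j"
proof -
  have "l = j" if l: "M l \<le> i" "i < 2 * M l" for l
  proof (rule ccontr)
    assume "l \<noteq> j"
    then consider "Suc l \<le> j" | "Suc j \<le> l" by linarith
    then show False
      using M_mono[of "Suc l" j] M_mono[of "Suc j" l] two_M_le[of l] two_M_le[of j] assms l
      by cases linarith+
  qed
  then have "{l. M l \<le> i \<and> i < 2 * M l} = {j}" using assms by blast
  then show ?thesis by (simp add: block_coeff_def)
qed

lemma block_coeff_out:
  assumes "2 * M j \<le> i" "i < M (Suc j)"
  shows "block_coeff d i = 0"
proof -
  have False if l: "M l \<le> i" "i < 2 * M l" for l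
  proof (cases "l \<le> j")
    case True
    then show False using M_mono[OF True] l assms by linarith
  next
    case False
    then show False using M_mono[of "Suc j" l] l assms by linarith
  qed
  then have "{l. M l \<le> i \<and> i < 2 * M l} = {}" by blast
  then show ?thesis by (simp only: block_coeff_def sum.empty)
qed

text \<open>The first block starts at \<open>M 0 = 1\<close>.\<close>

lemma block_coeff_0: "block_coeff d 0 = 0"
proof -
  have "{j. M j \<le> 0 \<and> 0 < 2 * M j} = {}" by auto
  then show ?thesis by (simp only: block_coeff_def sum.empty)
qed

lemma block_coeff_nonneg: "(\<And>j. 0 \<le> d j) \<Longrightarrow> 0 \<le> block_coeff d i"
  by (simp add: block_coeff_def sum_nonneg)

text \<open>Kept general in \<open>g\<close>: characters give the kernel form of the series, and
  \<open>g = 1\<close> gives the total mass of the coefficients.\<close>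

lemma sum_block_coeff:
  fixes g :: "nat \<Rightarrow> 'a::real_algebra_1"
  shows "(\<Sum>i<M n. of_real (block_coeff d i) * g i) =
    (\<Sum>j<n. of_real (d j) * (\<Sum>i<M j. g (M j + i)))"
proof (induction n)
  case 0
  then show ?case by (simp add: block_coeff_0)
next
  case (Suc n)
  let ?h = "\<lambda>i. of_real (block_coeff d i) * g i"
  \<comment> \<open>The middle range is block \<open>n\<close>; the last one is a gap, empty when
    \<open>m n = 2\<close>.\<close>
  have "sum ?h {..<M (Suc n)} = sum ?h {..<M n} + sum ?h {M n..<2 * M n} + sum ?h {2 * M n..<M (Suc n)}"
    using two_M_le[of n] by (simp add: lessThan_atLeast0 sum.atLeastLessThan_concat del: vil_M.simps)
  also have "sum ?h {2 * M n..<M (Suc n)} = 0"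
    by (intro sum.neutral ballI) (simp add: block_coeff_out[of n] del: vil_M.simps)
  also have "sum ?h {M n..<2 * M n} = (\<Sum>i\<in>{M n..<2 * M n}. of_real (d n) * g i)"
    by (rule sum.cong) (auto simp: block_coeff_in[of n])
  also have "\<dots> = of_real (d n) * (\<Sum>i<M n. g (M n + i))"
    by (subst sum.atLeastLessThan_shift_0) (simp add: atLeast0LessThan sum_distrib_left)
  finally show ?case by (simp add: Suc.IH)
qed

lemma block_martingale_eq:
  assumes x: "x \<in> vil_group m"
  shows "block_martingale d n x =
    (\<Sum>j<n. of_real (d j) * (vil_r m j x * of_real (M j * (indicator (vil_I m j (\<lambda>_. 0)) x :: real))))"
proof -
  \<comment> \<open>This is \<open>psi_shift\<close> with \<open>a = 1\<close>, a residue since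
    \<open>m j \<ge> 2\<close>: each block is a modulated Dirichlet kernel.\<close>
  have "(\<Sum>i<M j. vil_psi m (M j + i) x) = vil_r m j x * (\<Sum>i<M j. vil_psi m i x)" for j
    unfolding sum_distrib_left using psi_shift[of _ j 1 x] m2[of j] by (intro sum.cong) auto
  then show ?thesis
    unfolding block_martingale_def sum_block_coeff by (simp only: dirichlet_kernel_indicator[OF x])
qed

lemma norm_block_martingale_le:
  fixes d :: "nat \<Rightarrow> real"
  assumes "x \<in> vil_group m" "\<And>j. 0 \<le> d j"
  shows "norm (block_martingale d n x) \<le> (\<Sum>j<n. d j * M j * (indicator (vil_I m j (\<lambda>_. 0)) x :: real))"
  unfolding block_martingale_eq[OF assms(1)]
  by (rule order_trans[OF norm_sum])
    (intro sum_mono, simp add: norm_mult norm_r assms(2) abs_mult indicator_def)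

lemma integrable_block_martingale: "integrable \<mu> (block_martingale d n)"
proof -
  have "integrable \<mu> (\<lambda>x. of_real (block_coeff d i) * (vil_psi m i x * cnj (vil_psi m 0 x)))" for i
    by (intro integrable_mult_right psi_integrable)
  then show ?thesis
    unfolding block_martingale_def[abs_def] by (auto simp: psi_0)
qed

lemma fourier_coeff_block_martingale:
  "fourier_coeff m \<mu> (block_martingale d n) k = (if k < M n then of_real (block_coeff d k) else 0)"
proof -
  have "fourier_coeff m \<mu> (block_martingale d n) k =
      (\<integral>x. (\<Sum>i<M n. of_real (block_coeff d i) * (vil_psi m i x * cnj (vil_psi m k x))) \<partial>\<mu>)"
    by (simp add: fourier_coeff_def block_martingale_def sum_distrib_right mult.assoc)
  also have "\<dots> = (\<Sum>i<M n. of_real (block_coeff d i) * (if i = k then 1 else 0))"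
    by (simp add: Bochner_Integration.integral_sum psi_orthonormal)
  also have "\<dots> = (if k < M n then of_real (block_coeff d k) else 0)"
    by (simp add: mult_delta_right)
  finally show ?thesis .
qed

text \<open>The sequence under the limit is constant from \<open>k = i\<close> on.\<close>

lemma martingale_coeff_block_martingale:
  "martingale_coeff m \<mu> (block_martingale d) i = of_real (block_coeff d i)"
  unfolding martingale_coeff_def
proof (intro limI tendsto_eventually eventually_sequentiallyI[of i])
  fix k assume "i \<le> k"
  then have "i < M k" using less_M[of k] by linarith
  then show "fourier_coeff m \<mu> (block_martingale d k) i = of_real (block_coeff d i)"
    by (simp add: fourier_coeff_block_martingale)
qed

text \<open>Every preimage is a union of cells, and there are only countably many cells because a
  cell is coded by the list of its first \<open>n\<close> coordinates.\<close>

lemma measurable_vil_F: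
  fixes f :: "(nat \<Rightarrow> nat) \<Rightarrow> 'b::topological_space"
  assumes f: "\<And>x y. x \<in> vil_group m \<Longrightarrow> y \<in> vil_group m \<Longrightarrow> (\<And>k. k < n \<Longrightarrow> x k = y k) \<Longrightarrow> f x = f y"
  shows "f \<in> borel_measurable (vil_F m n)"
proof (rule measurableI)
  let ?cells = "vil_I m n ` vil_group m"
  have sub: "?cells \<subseteq> Pow (vil_group m)" by (auto simp: vil_I_def)
  have space: "space (vil_F m n) = vil_group m"
    and sets: "sets (vil_F m n) = sigma_sets (vil_group m) ?cells"
    unfolding vil_F_def by (simp_all add: space_measure_of[OF sub] sets_measure_of[OF sub])
  have "vil_I m n x = (\<lambda>xs. {y \<in> vil_group m. \<forall>k<n. y k = xs ! k}) (map x [0..<n])" for x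
    by (auto simp: vil_I_def)
  then have "range (vil_I m n) \<subseteq> range (\<lambda>xs :: nat list. {y \<in> vil_group m. \<forall>k<n. y k = xs ! k})"
    by blast
  then have countable: "countable (range (vil_I m n))"
    by (rule countable_subset) simp
  fix B assume "B \<in> sets (borel :: 'b measure)"
  have "f -` B \<inter> space (vil_F m n) = \<Union> (vil_I m n ` (f -` B \<inter> vil_group m))"
  proof (intro set_eqI iffI)
    fix y assume "y \<in> f -` B \<inter> space (vil_F m n)"
    then show "y \<in> \<Union> (vil_I m n ` (f -` B \<inter> vil_group m))"
      unfolding space by (intro UN_I[of y]) (auto simp: vil_I_def)
  next
    fix y assume "y \<in> \<Union> (vil_I m n ` (f -` B \<inter> vil_group m))"
    then obtain x where "f x \<in> B" "x \<in> vil_group m" "y \<in> vil_group m" "\<And>k. k < n \<Longrightarrow> y k = x k"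
      by (auto simp: vil_I_def)
    then show "y \<in> f -` B \<inter> space (vil_F m n)"
      using f[of y x] by (simp add: space)
  qed
  moreover have "\<Union> (vil_I m n ` (f -` B \<inter> vil_group m)) \<in> sets (vil_F m n)"
    by (intro sets.countable_Union countable_subset[OF _ countable])
      (auto simp: sets)
  ultimately show "f -` B \<inter> space (vil_F m n) \<in> sets (vil_F m n)" by simp
qed simp

lemma psi_cell:
  assumes "i < M n" "\<And>k. k < n \<Longrightarrow> x k = y k"
  shows "vil_psi m i x = vil_psi m i y"
  unfolding psi_eq_prod[OF assms(1)] vil_r_def using assms(2) by simp

text \<open>All members truncate one series, so a partial sum of order \<open>M n\<close> of a later
  member is the \<open>n\<close>-th one. Characters of index below \<open>M n\<close> see only the
  first \<open>n\<close> coordinates.\<close>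

lemma vil_martingale_block_martingale: "vil_martingale m \<mu> (block_martingale d)"
  unfolding vil_martingale_def
proof (intro conjI allI impI ballI integrable_block_martingale)
  fix n
  show "block_martingale d n \<in> borel_measurable (vil_F m n)"
  proof (rule measurable_vil_F)
    fix x y :: "nat \<Rightarrow> nat" assume "\<And>k. k < n \<Longrightarrow> x k = y k"
    then have "vil_psi m i x = vil_psi m i y" if "i < M n" for i
      using that by (rule psi_cell[rotated])
    then show "block_martingale d n x = block_martingale d n y"
      by (simp add: block_martingale_def)
  qed
  fix k x assume "n \<le> k"
  then show "partial_sum m \<mu> (M n) (block_martingale d k) x = block_martingale d n x"
    using M_mono[of n k] unfolding partial_sum_def block_martingale_def[of d n]
    by (intro sum.cong) (simp_all add: fourier_coeff_block_martingale)
qed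

section \<open>Membership in the Hardy space\<close>

lemma block_martingale_in_hardy_space:
  fixes d :: "nat \<Rightarrow> real"
  assumes p: "0 < p" "p \<le> 1" and d: "\<And>j. 0 \<le> d j"
    and summable: "summable (\<lambda>j. (d j * M j) powr p / M j)"
  shows "block_martingale d \<in> hardy_space m \<mu> p"
proof -
  define g where "g = (\<lambda>j x. (d j * M j) powr p * (indicator (vil_I m j (\<lambda>_. 0)) x :: real))"
  have g_nonneg: "0 \<le> g j x" for j x by (simp add: g_def)
  have bound: "ennreal_powr (maximal_function (block_martingale d) x) p \<le> (\<Sum>j. ennreal (g j x))"
    if x: "x \<in> vil_group m" for x
  \<comment> \<open>Divergence can occur only at the zero sequence, the one point common to all the
    cells; the bound is then trivial.\<close>
  proof (cases "(\<Sum>j. ennreal (g j x)) = top")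
    case True
    then show ?thesis by simp
  next
    case False
    then have summ: "summable (\<lambda>j. g j x)" by (simp add: summable_suminf_not_top g_nonneg)
    define s where "s = (\<Sum>j. g j x)"
    have s0: "0 \<le> s" unfolding s_def using summ g_nonneg by (intro suminf_nonneg)
    have le: "norm (block_martingale d n x) \<le> s powr (1 / p)" for n
    proof -
      let ?b = "\<lambda>j. d j * M j * (indicator (vil_I m j (\<lambda>_. 0)) x :: real)"
      have "norm (block_martingale d n x) powr p \<le> (\<Sum>j<n. ?b j) powr p"
        using norm_block_martingale_le[OF x, of d n] d p by (intro powr_mono2) auto
      also have "\<dots> \<le> (\<Sum>j<n. ?b j powr p)"
        by (rule powr_sum_le) (use d p in auto)
      also have "\<dots> = (\<Sum>j<n. g j x)"
        using p by (intro sum.cong) (auto simp: g_def indicator_def)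
      also have "\<dots> \<le> s"
        unfolding s_def by (intro sum_le_suminf summ) (auto simp: g_nonneg)
      finally have "(norm (block_martingale d n x) powr p) powr (1 / p) \<le> s powr (1 / p)"
        using p by (intro powr_mono2) auto
      then show ?thesis using p by (simp add: powr_powr)
    qed
    have max: "maximal_function (block_martingale d) x \<le> ennreal (s powr (1 / p))"
      unfolding maximal_function_def by (intro SUP_least ennreal_leI le)
    \<comment> \<open>The finite bound places the maximal function in the real branch of
      \<open>ennreal_powr\<close>.\<close>
    then obtain r where r: "0 \<le> r" "maximal_function (block_martingale d) x = ennreal r"
      by (metis ennreal_cases ennreal_neq_top top.extremum_unique)
    with max have "r \<le> s powr (1 / p)" by simp
    then have "r powr p \<le> (s powr (1 / p)) powr p" using p r by (intro powr_mono2) auto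
    also have "\<dots> = s" using p s0 by (simp add: powr_powr)
    finally show ?thesis
      using r s0 by (simp add: ennreal_powr_def suminf_ennreal2[OF g_nonneg summ] s_def[symmetric])
  qed
  have int_g: "(\<integral>\<^sup>+ x. ennreal (g j x) \<partial>\<mu>) = ennreal ((d j * M j) powr p / M j)" for j
  proof -
    have "measure \<mu> (vil_I m j (\<lambda>_. 0)) = 1 / M j"
      using measure_I_zero[of j] M_pos[of j] by (simp add: field_simps)
    moreover have "(\<integral>\<^sup>+ x. ennreal (g j x) \<partial>\<mu>) =
        (\<integral>\<^sup>+ x. ennreal ((d j * M j) powr p) * indicator (vil_I m j (\<lambda>_. 0)) x \<partial>\<mu>)"
      by (intro nn_integral_cong) (auto simp: g_def indicator_def)
    ultimately show ?thesis
      by (simp add: nn_integral_cmult_indicator emeasure_eq_measure ennreal_mult[symmetric])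
  qed
  have "(\<integral>\<^sup>+ x. ennreal_powr (maximal_function (block_martingale d) x) p \<partial>\<mu>)
      \<le> (\<integral>\<^sup>+ x. (\<Sum>j. ennreal (g j x)) \<partial>\<mu>)"
    by (intro nn_integral_mono bound) (simp add: space_mu)
  also have "\<dots> = (\<Sum>j. \<integral>\<^sup>+ x. ennreal (g j x) \<partial>\<mu>)"
    by (intro nn_integral_suminf) (simp add: g_def)
  also have "\<dots> < top"
    unfolding int_g less_top[symmetric] by (intro ennreal_suminf_neq_top summable) simp
  finally have "(\<integral>\<^sup>+ x. ennreal_powr (maximal_function (block_martingale d) x) p \<partial>\<mu>) < top" .
  then show ?thesis
    by (simp add: hardy_space_def vil_martingale_block_martingale hardy_norm_def Lp_norm_def
        ennreal_powr_def)
qed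

section \<open>Lower bounds for the Noerlund means\<close>

text \<open>Characters have modulus 1 and the coefficients are nonnegative, so their total mass
  below \<open>M n\<close> is a bound; block \<open>j\<close> consists of \<open>M j\<close> copies
  of \<open>d j\<close>.\<close>

lemma norm_martingale_sum_le:
  fixes d :: "nat \<Rightarrow> real"
  assumes d: "\<And>j. 0 \<le> d j" and k: "k \<le> M n"
  shows "norm (martingale_sum m \<mu> k (block_martingale d) x) \<le> (\<Sum>j<n. d j * M j)"
proof -
  have "norm (martingale_sum m \<mu> k (block_martingale d) x) \<le> (\<Sum>i<k. block_coeff d i)"
    unfolding martingale_sum_def martingale_coeff_block_martingale
    by (rule order_trans[OF norm_sum]) (simp add: norm_mult norm_psi block_coeff_nonneg d)
  also have "\<dots> \<le> (\<Sum>i<M n. block_coeff d i)"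
    using k by (intro sum_mono2) (auto simp: block_coeff_nonneg d)
  also have "\<dots> = (\<Sum>j<n. d j * M j)"
    using sum_block_coeff[of d "\<lambda>_. 1::real" n] by simp
  finally show ?thesis .
qed

lemma norlund_mean_lower_bound:
  fixes d :: "nat \<Rightarrow> real"
  assumes q: "norlund_weights q" and d: "\<And>j. 0 \<le> d j"
  shows "q 0 * d j / norlund_Q q (M j + 1) - (\<Sum>l<j. d l * M l)
    \<le> norm (norlund_mean m \<mu> q (M j + 1) (block_martingale d) x)"
proof -
  define S where "S = (\<lambda>k. martingale_sum m \<mu> k (block_martingale d) x)"
  define B where "B = (\<Sum>l<j. d l * M l)"
  define Q where "Q = norlund_Q q (M j + 1)"
  \<comment> \<open>\<open>R\<close> is the weighted sum with \<open>S (M j + 1)\<close> replaced by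
    \<open>S (M j)\<close>, so that it is free of block \<open>j\<close>.\<close>
  define R where "R = (\<Sum>k=1..M j. complex_of_real (q (M j + 1 - k)) * S k) + of_real (q 0) * S (M j)"
  have q0: "0 \<le> q k" "0 < q 0" for k using q by (auto simp: norlund_weights_def)
  have SB: "norm (S k) \<le> B" if "k \<le> M j" for k
    unfolding S_def B_def using norm_martingale_sum_le[OF d that] .
  \<comment> \<open>The weights of the mean, read in reverse order, are exactly the summands of
    \<open>Q\<close>; hence \<open>norm R \<le> Q * B\<close> below.\<close>
  have Q_eq: "Q = (\<Sum>k=1..M j. q (M j + 1 - k)) + q 0"
  proof -
    have "Q = (\<Sum>k<M j + 1. q (M j + 1 - Suc k))"
      unfolding Q_def norlund_Q_def by (rule sum.nat_diff_reindex[symmetric])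
    also have "\<dots> = (\<Sum>k=1..M j + 1. q (M j + 1 - k))"
      by (simp only: sum.atLeast1_atMost_eq One_nat_def)
    finally show ?thesis by simp
  qed
  have Q: "0 < Q" unfolding Q_eq using q0 by (intro add_nonneg_pos sum_nonneg) auto
  \<comment> \<open>Index \<open>M j\<close> opens block \<open>j\<close>, and
    \<open>M j + 1\<close> is the least order whose partial sum includes it.\<close>
  have "S (M j + 1) = S (M j) + of_real (d j) * vil_psi m (M j) x"
    using M_pos[of j] by (simp add: S_def martingale_sum_def martingale_coeff_block_martingale block_coeff_in[of j])
  then have "(\<Sum>k=1..M j + 1. complex_of_real (q (M j + 1 - k)) * S k) =
      R + of_real (q 0 * d j) * vil_psi m (M j) x"
    by (simp add: R_def algebra_simps)
  then have mean: "norlund_mean m \<mu> q (M j + 1) (block_martingale d) x =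
      of_real (1 / Q) * (R + of_real (q 0 * d j) * vil_psi m (M j) x)"
    unfolding norlund_mean_def Q_def by (simp only: S_def)
  have "norm R \<le> (\<Sum>k=1..M j. q (M j + 1 - k) * B) + q 0 * B"
    unfolding R_def using q0 SB
    by (intro order_trans[OF norm_triangle_ineq] add_mono order_trans[OF norm_sum] sum_mono)
      (auto simp: norm_mult intro!: mult_left_mono)
  also have "\<dots> = Q * B" by (simp add: Q_eq sum_distrib_right distrib_right)
  finally have R: "norm R \<le> Q * B" .
  have "q 0 * d j - Q * B \<le> norm (of_real (q 0 * d j) * vil_psi m (M j) x) - norm R"
    using R q0 d[of j] by (simp add: norm_mult norm_psi abs_mult)
  also have "\<dots> \<le> norm (R + of_real (q 0 * d j) * vil_psi m (M j) x)"
    by (metis add.commute norm_diff_ineq)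
  finally have "(q 0 * d j - Q * B) / Q \<le> norm (R + of_real (q 0 * d j) * vil_psi m (M j) x) / Q"
    using Q by (intro divide_right_mono) auto
  also have "\<dots> = norm (norlund_mean m \<mu> q (M j + 1) (block_martingale d) x)"
    unfolding mean using Q by (simp add: norm_mult norm_divide)
  finally show ?thesis using Q unfolding Q_def[symmetric] B_def[symmetric] by (simp add: diff_divide_distrib)
qed

text \<open>The level set at \<open>t\<close> is the whole space, of measure 1.\<close>

lemma weak_Lp_norm_ge:
  assumes "\<And>x. t < norm (g x)" "0 < t"
  shows "ennreal t \<le> weak_Lp_norm \<mu> p g"
proof -
  have "{x \<in> space \<mu>. t < norm (g x)} = space \<mu>" using assms by auto
  then have "ennreal t = ennreal t * ennreal_powr (emeasure \<mu> {x \<in> space \<mu>. t < norm (g x)}) (1 / p)"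
    by (simp add: emeasure_space_1 ennreal_powr_def)
  also have "\<dots> \<le> weak_Lp_norm \<mu> p g"
    unfolding weak_Lp_norm_def using assms by (intro SUP_upper) auto
  finally show ?thesis .
qed

section \<open>Choice of the coefficients\<close>

lemma unbounded_norlund_means:
  assumes p: "0 < p" "p \<le> 1" and q: "norlund_weights q"
    and growth: "\<And>K N. \<exists>j\<ge>N. K < M j powr (1 / p - 1) / norlund_Q q (M j + 1)"
  shows "\<exists>f\<in>hardy_space m \<mu> p. (SUP n\<in>{1..}. weak_Lp_norm \<mu> p (norlund_mean m \<mu> q n f)) = \<infinity>"
proof -
  \<comment> \<open>Chosen so that \<open>lam k powr p = (1 / 2) ^ k\<close>, which turns the Hardy
    space condition into a geometric series.\<close>
  define lam where "lam k = ((1 / 2) ^ k) powr (1 / p)" for k :: nat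
  \<comment> \<open>Bounds the mass of the blocks up to \<open>n\<close> for every admissible choice
    of coefficients, so the positions can be chosen recursively before \<open>d\<close> is
    defined.\<close>
  define R where "R n = (\<Sum>l\<le>n. M l powr (1 / p))" for n
  define A where "A j = M j powr (1 / p - 1) / norlund_Q q (M j + 1)" for j
  have q0: "0 < q 0" using q by (simp add: norlund_weights_def)
  have lam_bounds: "0 < lam k" "lam k \<le> 1" for k
    using p by (simp_all add: lam_def powr_le1 power_le_one)
  have "\<exists>n'>n. real k + 2 + R n < q 0 * lam (Suc k) * A n'" for k n
  proof -
    obtain j where "j \<ge> Suc n" "(real k + 2 + R n) / (q 0 * lam (Suc k)) < A j"
      using growth unfolding A_def by blast
    then show ?thesis using q0 lam_bounds[of "Suc k"]
      by (intro exI[of _ j]) (auto simp: field_simps)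
  qed
  \<comment> \<open>\<open>True\<close> fills the place of the invariant in
    \<open>dependent_nat_choice\<close>; only the relation between consecutive positions
    matters.\<close>
  then have "\<exists>N. \<forall>k. True \<and> N k < N (Suc k) \<and> real k + 2 + R (N k) < q 0 * lam (Suc k) * A (N (Suc k))"
    by (intro dependent_nat_choice) auto
  then obtain N where N: "\<And>k. N k < N (Suc k)"
      "\<And>k. real k + 2 + R (N k) < q 0 * lam (Suc k) * A (N (Suc k))"
    by blast
  have mono: "strict_mono N" using N(1) by (simp add: strict_mono_Suc_iff)
  define d where "d j = (if j \<in> range N then lam (inv N j) * M j powr (1 / p - 1) else 0)" for j
  have d_N: "d (N k) = lam k * M (N k) powr (1 / p - 1)" for k
    using strict_mono_imp_inj_on[OF mono] by (simp add: d_def)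
  have d0: "0 \<le> d j" for j using lam_bounds(1)[of "inv N j"] by (simp add: d_def)
  have M1: "M j powr (1 / p - 1) * M j = M j powr (1 / p)" for j
    using M_pos[of j] by (simp add: powr_diff)
  have d_le: "d j * M j \<le> M j powr (1 / p)" for j
    using lam_bounds[of "inv N j"] by (simp add: d_def M1 mult.assoc mult_left_le_one_le)
  have "summable (\<lambda>k. (d (N k) * M (N k)) powr p / M (N k))"
  proof -
    have "(d (N k) * M (N k)) powr p / M (N k) = (1 / 2) ^ k" for k
      using p M_pos[of "N k"] by (simp add: d_N M1 mult.assoc lam_def powr_mult powr_powr)
    then show ?thesis by (simp add: summable_geometric)
  qed
  then have "summable (\<lambda>j. (d j * M j) powr p / M j)"
    by (subst (asm) summable_mono_reindex[OF mono]) (auto simp: d_def p)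
  then have hardy: "block_martingale d \<in> hardy_space m \<mu> p"
    by (intro block_martingale_in_hardy_space p d0)
  have "ennreal (real k) \<le> (SUP n\<in>{1..}. weak_Lp_norm \<mu> p (norlund_mean m \<mu> q n (block_martingale d)))" for k
  proof -
    let ?j = "N (Suc k)"
    \<comment> \<open>Strictly between \<open>N k\<close> and \<open>N (Suc k)\<close> all
      coefficients vanish.\<close>
    have "(\<Sum>l<?j. d l * M l) = (\<Sum>l\<le>N k. d l * M l)"
    proof (rule sum.mono_neutral_right)
      show "{..N k} \<subseteq> {..<?j}" using N(1)[of k] by auto
      show "\<forall>l\<in>{..<?j} - {..N k}. d l * M l = 0"
        using mono by (auto simp: d_def strict_mono_less not_le less_Suc_eq_le)
    qed simp
    also have "\<dots> \<le> R (N k)" unfolding R_def by (intro sum_mono d_le)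
    finally have B: "(\<Sum>l<?j. d l * M l) \<le> R (N k)" .
    have "q 0 * d ?j / norlund_Q q (M ?j + 1) = q 0 * lam (Suc k) * A ?j"
      by (simp add: d_N A_def)
    moreover have "q 0 * d ?j / norlund_Q q (M ?j + 1) - (\<Sum>l<?j. d l * M l)
        \<le> norm (norlund_mean m \<mu> q (M ?j + 1) (block_martingale d) x)" for x
      using q d0 by (rule norlund_mean_lower_bound)
    ultimately have "real k + 1 < norm (norlund_mean m \<mu> q (M ?j + 1) (block_martingale d) x)" for x
      using B N(2)[of k] by (smt (verit))
    then have "ennreal (real k + 1) \<le> weak_Lp_norm \<mu> p (norlund_mean m \<mu> q (M ?j + 1) (block_martingale d))"
      by (intro weak_Lp_norm_ge) auto
    then have "ennreal (real k) \<le> weak_Lp_norm \<mu> p (norlund_mean m \<mu> q (M ?j + 1) (block_martingale d))"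
      by (rule order_trans[rotated]) (simp add: ennreal_leI)
    then show ?thesis by (rule SUP_upper2[rotated]) simp
  qed
  then have "(SUP n\<in>{1..}. weak_Lp_norm \<mu> p (norlund_mean m \<mu> q n (block_martingale d))) = \<infinity>"
    by (metis ennreal_of_nat_eq_real_of_nat ennreal_Ex_less_of_nat infinity_ennreal_def less_top not_le)
  with hardy show ?thesis by blast
qed

section \<open>Growth of the quotient along \<open>M\<close>\<close>

text \<open>Replacing \<open>n\<close> by the \<open>M j\<close> with
  \<open>M j \<le> n < M (Suc j)\<close> costs at most \<open>C powr \<alpha>\<close> in the
  numerator, by boundedness of \<open>m\<close>, and a factor 2 in the denominator.\<close>

lemma growth_along_M:
  assumes q: "norlund_weights q" "decseq q" and \<alpha>: "0 < \<alpha>" and C: "\<And>k. m k \<le> C"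
    and freq: "\<And>N. \<exists>n\<ge>N. e < real n powr \<alpha> / norlund_Q q n"
  shows "\<exists>j\<ge>N. e / (2 * C powr \<alpha>) < M j powr \<alpha> / norlund_Q q (M j + 1)"
proof -
  have q0: "0 \<le> q k" "0 < q 0" "q k \<le> q 0" for k
    using q by (auto simp: norlund_weights_def decseq_def)
  have mono: "norlund_Q q a \<le> norlund_Q q b" if "a \<le> b" for a b
    unfolding norlund_Q_def using that q0 by (intro sum_mono2) auto
  \<comment> \<open>Taking \<open>n\<close> beyond \<open>M N\<close> forces
    \<open>N \<le> j\<close>.\<close>
  obtain n where n: "M N \<le> n" "e < real n powr \<alpha> / norlund_Q q n"
    using freq by blast
  define k where "k = (LEAST k. n < M k)"
  have k: "n < M k" unfolding k_def by (rule LeastI[of _ n]) (rule less_M)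
  have "k \<noteq> 0"
    using k n(1) M_pos[of N] by (cases "k = 0") auto
  then obtain j where j: "k = Suc j" using not0_implies_Suc by blast
  have "\<not> n < M j" using not_less_Least[of j "\<lambda>k. n < M k"] by (simp add: k_def[symmetric] j)
  then have Mj: "M j \<le> n" by simp
  have "N \<le> j"
    using M_mono[of k N] k n(1) by (cases "k \<le> N") (auto simp: j simp del: vil_M.simps)
  have "M k \<le> C * M j" unfolding j vil_M.simps using C by (rule mult_right_mono) simp
  then have "n \<le> C * M j" using k by linarith
  then have "real n \<le> C * M j" by (metis of_nat_le_iff of_nat_mult)
  then have num: "real n powr \<alpha> \<le> C powr \<alpha> * M j powr \<alpha>"
    using \<alpha> by (simp add: powr_mult[symmetric] powr_mono2)
  have "C > 0" using C[of 0] m_pos[of 0] by linarith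
  have "q 0 = norlund_Q q 1" by (simp add: norlund_Q_def)
  also have "\<dots> \<le> norlund_Q q (M j)" using M_pos[of j] by (intro mono) simp
  finally have Q0: "q 0 \<le> norlund_Q q (M j)" .
  moreover have "norlund_Q q (M j + 1) = norlund_Q q (M j) + q (M j)" by (simp add: norlund_Q_def)
  \<comment> \<open>As \<open>q\<close> is non-increasing, the one extra weight is at most
    \<open>q 0\<close>, hence at most \<open>norlund_Q q (M j)\<close>.\<close>
  ultimately have "norlund_Q q (M j + 1) \<le> 2 * norlund_Q q (M j)" using q0(3)[of "M j"] by linarith
  also have "\<dots> \<le> 2 * norlund_Q q n" using mono[OF Mj] by simp
  finally have den: "norlund_Q q (M j + 1) / 2 \<le> norlund_Q q n" by simp
  have Qpos: "0 < norlund_Q q (M j + 1)" using mono[of "M j" "M j + 1"] Q0 q0(2) by linarith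
  have "e < C powr \<alpha> * M j powr \<alpha> / (norlund_Q q (M j + 1) / 2)"
    using n(2) num den Qpos by (intro less_le_trans[OF n(2)] frac_le) auto
  then have "e / (2 * C powr \<alpha>) < M j powr \<alpha> / norlund_Q q (M j + 1)"
    using \<open>C > 0\<close> by (simp add: field_simps)
  with \<open>N \<le> j\<close> show ?thesis by blast
qed

end

section \<open>Deduction of both statements from the upper limits\<close>

lemma less_limsup_imp_frequently:
  assumes "ereal e < limsup (\<lambda>n. ereal (f n))"
  shows "\<exists>n\<ge>N. e < f n"
proof (rule ccontr)
  assume "\<not> ?thesis"
  then have "eventually (\<lambda>n. ereal (f n) \<le> ereal e) sequentially"
    by (auto simp: eventually_sequentially not_less)
  then have "limsup (\<lambda>n. ereal (f n)) \<le> ereal e" by (rule Limsup_bounded)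
  with assms show False by simp
qed

theorem theorem4p8:
  fixes m :: "nat \<Rightarrow> nat" and \<mu> :: "(nat \<Rightarrow> nat) measure"
  assumes "\<forall>k. 2 \<le> m k" and "bdd_above (range m)" and "haar_probability m \<mu>"
  shows "(\<forall>(\<alpha>::real) (p::real) (q::nat \<Rightarrow> real) (c::ereal).
            0 < \<alpha> \<and> \<alpha> \<le> 1 \<and> 0 < p \<and> p < 1 / (1 + \<alpha>) \<and>
            norlund_weights q \<and> decseq q \<and>
            limsup (\<lambda>n. ereal (real n powr \<alpha> / norlund_Q q n)) = c \<and> 0 < c \<longrightarrow>
            (\<exists>f\<in>hardy_space m \<mu> p.
               (SUP n\<in>{1..}. weak_Lp_norm \<mu> p (norlund_mean m \<mu> q n f)) = \<infinity>))
       \<and> (\<forall>(\<alpha>::real) (q::nat \<Rightarrow> real).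
            0 < \<alpha> \<and> \<alpha> \<le> 1 \<and>
            norlund_weights q \<and> decseq q \<and>
            limsup (\<lambda>n. ereal (real n powr \<alpha> / norlund_Q q n)) = \<infinity> \<longrightarrow>
            (\<exists>f\<in>hardy_space m \<mu> (1 / (1 + \<alpha>)).
               (SUP n\<in>{1..}. weak_Lp_norm \<mu> (1 / (1 + \<alpha>)) (norlund_mean m \<mu> q n f)) = \<infinity>))"
proof -
  interpret vilenkin m \<mu> using assms by unfold_locales auto
  obtain C where C: "\<And>k. m k \<le> C" using assms(2) by (auto simp: bdd_above_def)
  have Cpos: "0 < C" using C[of 0] m_pos[of 0] by linarith
  show ?thesis
  proof (intro conjI allI impI; elim conjE)
    fix \<alpha> p :: real and q and c :: ereal
    assume \<alpha>: "0 < \<alpha>" "\<alpha> \<le> 1" and p: "0 < p" "p < 1 / (1 + \<alpha>)" and q: "norlund_weights q" "decseq q"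
      and lim: "limsup (\<lambda>n. ereal (real n powr \<alpha> / norlund_Q q n)) = c" "0 < c"
    \<comment> \<open>\<open>c\<close> may be infinite, so a positive real below it is used
      instead.\<close>
    obtain e where e: "0 < e" "ereal e < c"
      using ereal_dense2[OF lim(2)] by auto
    have freq: "\<exists>n\<ge>N. e < real n powr \<alpha> / norlund_Q q n" for N
      by (rule less_limsup_imp_frequently) (simp add: lim(1) e(2))
    define e' where "e' = e / (2 * C powr \<alpha>)"
    \<comment> \<open>The surplus exponent: \<open>1 / p - 1 = \<alpha> + \<delta>\<close>. A
      positive upper limit only keeps the quotient with exponent \<alpha> away from 0 infinitely
      often; \<open>M j powr \<delta>\<close> makes it unbounded.\<close>
    define \<delta> where "\<delta> = 1 / p - 1 - \<alpha>"
    have e': "0 < e'" using e(1) Cpos by (simp add: e'_def)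
    have "1 + \<alpha> < 1 / p" using p \<alpha> by (simp add: field_simps)
    then have \<delta>: "0 < \<delta>" by (simp add: \<delta>_def)
    show "\<exists>f\<in>hardy_space m \<mu> p. (SUP n\<in>{1..}. weak_Lp_norm \<mu> p (norlund_mean m \<mu> q n f)) = \<infinity>"
    proof (rule unbounded_norlund_means[OF p(1) _ q(1)])
      show "p \<le> 1" using p \<alpha> by (simp add: field_simps) (smt (verit) mult_nonneg_nonneg)
      fix K N
      \<comment> \<open>The size \<open>M j powr \<delta>\<close> must reach to exceed
        \<open>K\<close>; \<open>\<bar>K\<bar> + 1\<close> keeps it positive. The choice of
        \<open>j\<close> below ensures it through \<open>j < M j\<close>.\<close>
      define T where "T = (\<bar>K\<bar> + 1) / e'"
      have T: "0 < T" "K \<le> T * e'" using e' by (auto simp: T_def)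
      obtain j where j: "max N (nat \<lceil>T powr (1 / \<delta>)\<rceil>) \<le> j"
          "e' < M j powr \<alpha> / norlund_Q q (M j + 1)"
        using growth_along_M[OF q \<alpha>(1) C freq] unfolding e'_def by blast
      have "T powr (1 / \<delta>) \<le> real (M j)" using j(1) less_M[of j] by linarith
      then have "(T powr (1 / \<delta>)) powr \<delta> \<le> M j powr \<delta>" using \<delta> by (intro powr_mono2) auto
      then have "T \<le> M j powr \<delta>" using \<delta> T by (simp add: powr_powr)
      then have "T * e' < M j powr \<delta> * (M j powr \<alpha> / norlund_Q q (M j + 1))"
        using j(2) T(1) e' by (intro mult_le_less_imp_less) auto
      also have "\<dots> = M j powr (1 / p - 1) / norlund_Q q (M j + 1)"
        by (simp add: \<delta>_def powr_add[symmetric])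
      finally show "\<exists>j\<ge>N. K < M j powr (1 / p - 1) / norlund_Q q (M j + 1)"
        using T(2) j(1) by (intro exI[of _ j]) auto
    qed
  next
    fix \<alpha> :: real and q
    assume \<alpha>: "0 < \<alpha>" "\<alpha> \<le> 1" and q: "norlund_weights q" "decseq q"
      and lim: "limsup (\<lambda>n. ereal (real n powr \<alpha> / norlund_Q q n)) = \<infinity>"
    show "\<exists>f\<in>hardy_space m \<mu> (1 / (1 + \<alpha>)).
        (SUP n\<in>{1..}. weak_Lp_norm \<mu> (1 / (1 + \<alpha>)) (norlund_mean m \<mu> q n f)) = \<infinity>"
    proof (rule unbounded_norlund_means[OF _ _ q(1)])
      fix K N
      \<comment> \<open>The extra factor compensates the loss in \<open>growth_along_M\<close>. Here
        \<open>1 / p - 1\<close> is exactly \<alpha>, so the infinite upper limit supplies all the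
        growth.\<close>
      have "\<exists>n\<ge>N. K * (2 * C powr \<alpha>) < real n powr \<alpha> / norlund_Q q n" for N
        by (rule less_limsup_imp_frequently) (simp add: lim)
      from growth_along_M[OF q \<alpha>(1) C this, of N]
      show "\<exists>j\<ge>N. K < M j powr (1 / (1 / (1 + \<alpha>)) - 1) / norlund_Q q (M j + 1)"
        using Cpos by simp
    qed (use \<alpha> in auto)
  qed
qed

end
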